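(* Let $\hat{U}$ and $U$ be two bounded domains in $\mathbb{C}^n$ with $\hat{U}\subset U$. Then their Bergman kernels $K_{\hat{U}}$ and $K_U$ are equal on $\hat{U}$ if and only if $U\setminus\hat{U}$ is a Bergman-negligible subset of $U$.
   Context: The Bergman kernel $K_U(z,w)$ of a domain $U$ is the reproducing kernel of the Hilbert space $A^2(U)$ of $L^2$-holomorphic functions (holomorphic functions square-integrable with respect to Lebesgue measure); "$K_{\hat U}=K_U$ on $\hat U$" refers to the on-diagonal kernels, i.e. $K_{\hat U}(z,z)=K_U(z,z)$ for all $z\in\hat U$. A (relatively) closed subset $F$ of a domain $U\subset\mathbb{C}^n$ is called a Bergman-negligible subset of $U$ if $F$ has Lebesgue measure zero and every $L^2$-holomorphic function on $U\setminus F$ extends as an $L^2$-holomorphic function on $U$. ($F$ is allowed to be empty.) *)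

theory Defs
  imports "HOL-Analysis.Analysis"
begin

definition domain_Cn :: "(complex ^ 'n) set \<Rightarrow> bool" where
  "domain_Cn U \<longleftrightarrow> open U \<and> connected U \<and> U \<noteq> {}"

text \<open>
  The library's \<open>holomorphic_on\<close> covers one complex variable only. In several variables,
  holomorphic means complex differentiable at every point: the Frechet derivative exists and
  is linear over the complex numbers. (Additivity is part of \<open>has_derivative\<close>; the operation
  \<open>*s\<close> is scalar multiplication by a complex number.)
\<close>

definition holomorphic_Cn_on :: "(complex ^ 'n \<Rightarrow> complex) \<Rightarrow> (complex ^ 'n) set \<Rightarrow> bool" where
  "holomorphic_Cn_on f U \<longleftrightarrow>
     (\<forall>z\<in>U. \<exists>f'. (f has_derivative f') (at z within U) \<and> (\<forall>c v. f' (c *s v) = c * f' v))"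

text \<open>
  Elements of the Bergman space are represented by total functions; only their values on \<open>U\<close>
  matter, so two representatives are the same element iff they agree on \<open>U\<close>.
\<close>

definition bergman_space :: "(complex ^ 'n) set \<Rightarrow> (complex ^ 'n \<Rightarrow> complex) set" where
  "bergman_space U =
     {f. holomorphic_Cn_on f U \<and> set_integrable lebesgue U (\<lambda>z. (cmod (f z))\<^sup>2)}"

definition bergman_inner ::
    "(complex ^ 'n) set \<Rightarrow> (complex ^ 'n \<Rightarrow> complex) \<Rightarrow> (complex ^ 'n \<Rightarrow> complex) \<Rightarrow> complex" where
  "bergman_inner U f g = (LINT z:U|lebesgue. f z * cnj (g z))"

definition is_bergman_kernel ::
    "(complex ^ 'n) set \<Rightarrow> (complex ^ 'n \<Rightarrow> complex ^ 'n \<Rightarrow> complex) \<Rightarrow> bool" where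
  "is_bergman_kernel U K \<longleftrightarrow>
     (\<forall>w\<in>U. (\<lambda>z. K z w) \<in> bergman_space U \<and>
        (\<forall>f\<in>bergman_space U. f w = bergman_inner U f (\<lambda>z. K z w)))"

text \<open>
  For open \<open>U\<close> a reproducing kernel exists and is uniquely determined on \<open>U \<times> U\<close>;
  the choice operator only affects the irrelevant values elsewhere.
\<close>

definition bergman_kernel ::
    "(complex ^ 'n) set \<Rightarrow> complex ^ 'n \<Rightarrow> complex ^ 'n \<Rightarrow> complex" where
  "bergman_kernel U = (SOME K. is_bergman_kernel U K)"

definition bergman_negligible :: "(complex ^ 'n) set \<Rightarrow> (complex ^ 'n) set \<Rightarrow> bool" where
  "bergman_negligible U F \<longleftrightarrow>
     closedin (top_of_set U) F \<and> F \<in> null_sets lebesgue \<and>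
     (\<forall>f\<in>bergman_space (U - F). \<exists>g\<in>bergman_space U. \<forall>z\<in>U - F. g z = f z)"

end

theory Submission
  imports Defs "HOL-Complex_Analysis.Complex_Analysis"
begin

text \<open>
  Write \<open>k\<^sub>w = K\<^sub>U(\<cdot>,w)\<close> and \<open>p\<^sub>w = K\<^sub>V(\<cdot>,w)\<close> for \<open>w \<in> V\<close>. If the kernels agree on the diagonal, the
  reproducing property gives \<open>\<parallel>k\<^sub>w - p\<^sub>w\<parallel>\<^sub>V\<^sup>2 = \<parallel>k\<^sub>w\<parallel>\<^sub>V\<^sup>2 - \<parallel>k\<^sub>w\<parallel>\<^sub>U\<^sup>2 \<le> 0\<close>. Hence \<open>k\<^sub>w = p\<^sub>w\<close> on \<open>V\<close>, and
  \<open>k\<^sub>w = 0\<close> almost everywhere on \<open>U - V\<close>. Outside a null set, a point \<open>z \<in> U - V\<close> therefore satisfies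
  \<open>K\<^sub>U(w,z) = 0\<close> for all \<open>w\<close> in a countable dense subset of \<open>V\<close>, so \<open>K\<^sub>U(\<cdot>,z)\<close> vanishes on \<open>V\<close>, and on
  the connected set \<open>U\<close> by the identity theorem; this contradicts \<open>\<langle>1, K\<^sub>U(\<cdot>,z)\<rangle> = 1\<close>, where the
  boundedness of \<open>U\<close> puts \<open>1\<close> in the Bergman space. So \<open>U - V\<close> is null. An extension \<open>g\<close> of
  \<open>f \<in> A\<^sup>2(V)\<close> is the Riesz representative of \<open>\<phi> \<mapsto> \<langle>\<phi>, f\<rangle>\<^sub>V\<close> on \<open>A\<^sup>2(U)\<close>: at \<open>w \<in> V\<close>,
  \<open>g(w) = \<langle>g, k\<^sub>w\<rangle>\<^sub>U = \<langle>f, k\<^sub>w\<rangle>\<^sub>V = \<langle>f, p\<^sub>w\<rangle>\<^sub>V = f(w)\<close>.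

  Conversely, if \<open>U - V\<close> is negligible then \<open>K\<^sub>U\<close> reproduces \<open>A\<^sup>2(V)\<close>, so it is the kernel of \<open>V\<close>.
\<close>

section \<open>The unitary invariance of Lebesgue measure\<close>

lemma nn_integral_lborel_translate:
  fixes f :: "'a::euclidean_space \<Rightarrow> ennreal"
  assumes [measurable]: "f \<in> borel_measurable borel"
  shows "(\<integral>\<^sup>+x. f (c + x) \<partial>lborel) = (\<integral>\<^sup>+x. f x \<partial>lborel)"
proof -
  have "(\<integral>\<^sup>+x. f x \<partial>lborel) = (\<integral>\<^sup>+x. f x \<partial>distr lborel borel ((+) c))"
    by (simp only: lborel_distr_plus)
  also have "\<dots> = (\<integral>\<^sup>+x. f (c + x) \<partial>lborel)"
    by (subst nn_integral_distr) auto
  finally show ?thesis ..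
qed

lemma nn_integral_lborel_reflect:
  fixes f :: "'a::euclidean_space \<Rightarrow> ennreal"
  assumes [measurable]: "f \<in> borel_measurable borel"
  shows "(\<integral>\<^sup>+x. f (c - x) \<partial>lborel) = (\<integral>\<^sup>+x. f x \<partial>lborel)"
proof -
  have "(\<integral>\<^sup>+x. f x \<partial>lborel) = (\<integral>\<^sup>+x. f x \<partial>distr lborel borel (\<lambda>x. c + (-1) *\<^sub>R x))"
    by (subst lborel_affine[of "-1" c]) (auto simp: density_1)
  also have "\<dots> = (\<integral>\<^sup>+x. f (c - x) \<partial>lborel)"
    by (subst nn_integral_distr) auto
  finally show ?thesis ..
qed

text \<open>
  The uniqueness argument for Haar measure: integrate \<open>f (T x) * 1\<^sub>B (T x + y)\<close> over both
  variables, where \<open>B\<close> is the unit ball, which \<open>T\<close> preserves.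
\<close>

lemma nn_integral_orthogonal_transformation:
  fixes f :: "'a::euclidean_space \<Rightarrow> ennreal"
  assumes T: "orthogonal_transformation (T :: 'a \<Rightarrow> 'a)" and [measurable]: "f \<in> borel_measurable borel"
  shows "(\<integral>\<^sup>+x. f (T x) \<partial>lborel) = (\<integral>\<^sup>+x. f x \<partial>lborel)"
proof -
  have lin: "linear T" and nT: "\<And>x. norm (T x) = norm x"
    using T by (auto simp: orthogonal_transformation)
  have [measurable]: "T \<in> borel_measurable borel"
    using lin by (intro borel_measurable_continuous_onI linear_continuous_on linear_conv_bounded_linear[THEN iffD1])
  define S where "S = inv T"
  have "surj T"
  proof (rule linear_injective_imp_surjective[OF lin])
    show "inj T"
      unfolding linear_injective_0[OF lin] by (metis nT norm_eq_zero)
  qed simp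
  then have TS: "T (S y) = y" for y
    by (simp add: S_def surj_f_inv_f)
  define B :: "'a set" where "B = ball 0 1"
  have [measurable]: "B \<in> sets borel" by (simp add: B_def)
  have BT: "indicator B (T x) = (indicator B x :: ennreal)" for x
    by (simp add: B_def indicator_def nT)
  \<comment> \<open>Both facts are needed to cancel the factor \<open>emeasure lborel B\<close> in
    \<open>ennreal\<close> at the end.\<close>
  have eB: "emeasure lborel B \<noteq> 0" "emeasure lborel B \<noteq> \<infinity>"
    using emeasure_lborel_ball_finite[of "0::'a" 1] content_ball_pos[of 1 "0::'a"]
    by (auto simp: B_def measure_def less_top)
  have "(\<integral>\<^sup>+x. f (T x) \<partial>lborel) * emeasure lborel B
      = (\<integral>\<^sup>+x. f (T x) * (\<integral>\<^sup>+y. indicator B y \<partial>lborel) \<partial>lborel)"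
    by (simp add: nn_integral_multc)
  also have "\<dots> = (\<integral>\<^sup>+x. (\<integral>\<^sup>+y. f (T x) * indicator B (T x + y) \<partial>lborel) \<partial>lborel)"
    by (simp add: nn_integral_lborel_translate[of "indicator B"] nn_integral_cmult)
  also have "\<dots> = (\<integral>\<^sup>+y. (\<integral>\<^sup>+x. f (T x) * indicator B (T x + y) \<partial>lborel) \<partial>lborel)"
    by (rule lborel_pair.Fubini'[symmetric]) measurable
  also have "\<dots> = (\<integral>\<^sup>+y. (\<integral>\<^sup>+x. f (T x - y) * indicator B x \<partial>lborel) \<partial>lborel)"
  proof (rule nn_integral_cong)
    \<comment> \<open>Shifting \<open>x\<close> by \<open>- S y\<close> turns \<open>T x\<close>
      into \<open>T x - y\<close>, so the indicator is evaluated at \<open>T x\<close> alone, where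
      invariance of the ball removes \<open>T\<close>. After Fubini, reflection and translation in
      \<open>y\<close> remove it from \<open>f\<close> as well.\<close>
    fix y
    have "(\<integral>\<^sup>+x. f (T x) * indicator B (T x + y) \<partial>lborel)
        = (\<integral>\<^sup>+x. f (T (- S y + x)) * indicator B (T (- S y + x) + y) \<partial>lborel)"
      by (rule nn_integral_lborel_translate[symmetric]) measurable
    also have "\<dots> = (\<integral>\<^sup>+x. f (T x - y) * indicator B x \<partial>lborel)"
      by (simp add: linear_diff[OF lin] TS BT)
    finally show "(\<integral>\<^sup>+x. f (T x) * indicator B (T x + y) \<partial>lborel)
        = (\<integral>\<^sup>+x. f (T x - y) * indicator B x \<partial>lborel)" .
  qed
  also have "\<dots> = (\<integral>\<^sup>+x. (\<integral>\<^sup>+y. f (T x - y) * indicator B x \<partial>lborel) \<partial>lborel)"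
    by (rule lborel_pair.Fubini') measurable
  also have "\<dots> = (\<integral>\<^sup>+x. (\<integral>\<^sup>+y. f y \<partial>lborel) * indicator B x \<partial>lborel)"
    by (simp add: nn_integral_multc nn_integral_lborel_reflect)
  also have "\<dots> = (\<integral>\<^sup>+y. f y \<partial>lborel) * emeasure lborel B"
    by (simp add: nn_integral_cmult)
  finally show ?thesis
    using eB by (metis mult_divide_eq_ennreal infinity_ennreal_def)
qed

text \<open>The image-measure form carries the invariance over to Bochner integrals of complex
  functions.\<close>

lemma lborel_distr_orthogonal_transformation:
  fixes T :: "'a::euclidean_space \<Rightarrow> 'a"
  assumes T: "orthogonal_transformation T"
  shows "distr lborel borel T = lborel"
proof (rule measure_eqI)
  fix A :: "'a set" assume "A \<in> sets (distr lborel borel T)"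
  then have [measurable]: "A \<in> sets borel" by simp
  have [measurable]: "T \<in> borel_measurable borel"
    using T by (intro borel_measurable_continuous_onI linear_continuous_on)
       (simp add: orthogonal_transformation_linear linear_conv_bounded_linear[symmetric])
  have "emeasure (distr lborel borel T) A = (\<integral>\<^sup>+x. indicator A (T x) \<partial>lborel)"
    by (subst nn_integral_indicator[symmetric], simp, subst nn_integral_distr) auto
  then show "emeasure (distr lborel borel T) A = emeasure lborel A"
    using nn_integral_orthogonal_transformation[OF T, of "indicator A"] by simp
qed simp

section \<open>Holomorphic functions of several variables\<close>

lemma norm_complex_vector_scalar_mult:
  fixes v :: "complex ^ 'n"
  shows "norm (c *s v) = cmod c * norm v"
  by (simp add: norm_vec_def norm_mult L2_set_right_distrib)

lemma continuous_on_vector_scalar_mult [continuous_intros]: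
  fixes g :: "'a::topological_space \<Rightarrow> complex ^ 'n"
  assumes "continuous_on S f" "continuous_on S g"
  shows "continuous_on S (\<lambda>x. f x *s g x)"
  unfolding vector_scalar_mult_def by (intro continuous_intros assms)

lemma orthogonal_transformation_unit_scalar:
  assumes "cmod c = 1"
  shows "orthogonal_transformation (\<lambda>v :: complex ^ 'n. c *s v)"
  unfolding orthogonal_transformation
  by (auto intro!: linearI simp: norm_complex_vector_scalar_mult assms vec_eq_iff algebra_simps)

lemma has_integral_cmul_cancel:
  fixes c :: complex
  assumes "((\<lambda>t. c * f t) has_integral c * l) S" "c \<noteq> 0"
  shows "(f has_integral l) S"
  using has_integral_mult_right[OF assms(1), of "inverse c"] assms(2)
  by (simp add: mult.assoc[symmetric])

text \<open>Cauchy's integral formula at the centre: on the unit circle, parametrised by [0,1], the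
  velocity is 2 pi i times the position, so the denominator cancels and only the constant 2 pi i
  remains to be divided out.\<close>

lemma circle_mean_value:
  assumes "f holomorphic_on S" "open S" "cball 0 1 \<subseteq> S"
  shows "(LINT t:{0..1}|lborel. f (exp (2 * of_real pi * \<i> * of_real t))) = f 0"
proof -
  have c: "continuous_on (cball 0 1) f"
    using assms holomorphic_on_imp_continuous_on continuous_on_subset by blast
  have "((\<lambda>u. f u / (u - 0)) has_contour_integral (2 * of_real pi * \<i> * f 0)) (circlepath 0 1)"
    using c assms by (intro Cauchy_integral_circlepath holomorphic_on_subset[OF assms(1)]) auto
  then have "((\<lambda>t. 2 * of_real pi * \<i> * f (exp (2 * of_real pi * \<i> * of_real t)))
      has_integral 2 * of_real pi * \<i> * f 0) {0..1}"
    unfolding has_contour_integral_def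
    by (rule has_integral_eq[rotated])
       (simp add: vector_derivative_circlepath01, simp add: circlepath)
  moreover have "2 * of_real pi * \<i> \<noteq> (0 :: complex)"
    by simp
  ultimately have "((\<lambda>t. f (exp (2 * of_real pi * \<i> * of_real t))) has_integral f 0) {0..1}"
    by (rule has_integral_cmul_cancel)
  moreover have "set_integrable lborel {0..1} (\<lambda>t::real. f (exp (2 * of_real pi * \<i> * of_real t)))"
    unfolding set_integrable_def
    by (intro borel_integrable_compact continuous_on_compose2[OF c] continuous_intros) auto
  ultimately show ?thesis
    by (simp add: set_borel_integral_eq_integral(2) integral_unique)
qed

lemma holomorphic_Cn_on_subset:
  "holomorphic_Cn_on f U \<Longrightarrow> V \<subseteq> U \<Longrightarrow> holomorphic_Cn_on f V"
  unfolding holomorphic_Cn_on_def by (meson has_derivative_subset subsetD)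

lemma holomorphic_Cn_on_imp_continuous_on:
  "holomorphic_Cn_on f U \<Longrightarrow> continuous_on U f"
  unfolding holomorphic_Cn_on_def continuous_on_eq_continuous_within
  by (meson has_derivative_continuous)

text \<open>The chain rule along a complex line. Complex homogeneity of \<open>f'\<close> turns the
  real derivative of the slice into multiplication by \<open>f' v\<close>, which opens the way to
  one-variable theory.\<close>

lemma has_field_derivative_slice:
  fixes f :: "complex ^ 'n \<Rightarrow> complex"
  assumes d: "(f has_derivative f') (at (p + t *s v))" "\<And>c v. f' (c *s v) = c * f' v"
  shows "((\<lambda>s. f (p + s *s v)) has_field_derivative f' v) (at t)"
proof -
  have "((\<lambda>s. p + s *s v) has_derivative (\<lambda>s. s *s v)) (at t)"
  proof -
    have "bounded_linear (\<lambda>s. s *s v)"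
      by (rule bounded_linear_intro[where K="norm v"])
         (auto simp: norm_complex_vector_scalar_mult vec_eq_iff algebra_simps)
    from bounded_linear_imp_has_derivative[OF this] show ?thesis
      by (auto intro!: derivative_eq_intros)
  qed
  from has_derivative_compose[OF this d(1)]
  have "((\<lambda>s. f (p + s *s v)) has_derivative (\<lambda>s. s * f' v)) (at t)"
    by (simp add: d(2))
  also have "(\<lambda>s. s * f' v) = (*) (f' v)"
    by (simp add: fun_eq_iff mult.commute)
  finally show ?thesis
    by (simp add: has_field_derivative_def)
qed

lemma open_slice:
  fixes U :: "(complex ^ 'n) set"
  assumes "open U"
  shows "open {s. p + s *s v \<in> U}"
proof -
  have "continuous_on UNIV (\<lambda>s. p + s *s v)" by (intro continuous_intros)
  from open_vimage[OF assms this] show ?thesis by (simp add: vimage_def)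
qed

lemma holomorphic_on_slice:
  fixes f :: "complex ^ 'n \<Rightarrow> complex"
  assumes "holomorphic_Cn_on f U" "open U"
  shows "(\<lambda>s. f (p + s *s v)) holomorphic_on {s. p + s *s v \<in> U}"
proof (rule holomorphic_onI)
  fix s assume "s \<in> {s. p + s *s v \<in> U}"
  then have "p + s *s v \<in> U" by simp
  then obtain f' where "(f has_derivative f') (at (p + s *s v))" "\<And>c v. f' (c *s v) = c * f' v"
    using assms unfolding holomorphic_Cn_on_def by (metis at_within_open)
  from has_field_derivative_slice[OF this]
  show "(\<lambda>s. f (p + s *s v)) field_differentiable at s within {s. p + s *s v \<in> U}"
    using field_differentiable_at_within field_differentiable_def by blast
qed

section \<open>The identity theorem and the mean value property\<close>

text \<open>The interior \<open>Z\<close> of the zero set is open, and it is relatively closed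
  because a ball in \<open>U\<close> that meets \<open>Z\<close> lies in \<open>Z\<close>: each of
  its points is joined to a point of \<open>Z\<close> by a complex line, on which the one-variable
  identity theorem applies. Connectedness then gives \<open>Z = U\<close>.\<close>

lemma holomorphic_Cn_on_identity:
  fixes f :: "complex ^ 'n \<Rightarrow> complex"
  assumes f: "holomorphic_Cn_on f U" and U: "open U" "connected U"
    and W: "open W" "W \<noteq> {}" "W \<subseteq> U" "\<And>z. z \<in> W \<Longrightarrow> f z = 0"
    and z: "z \<in> U"
  shows "f z = 0"
proof -
  define Z where "Z = interior {z\<in>U. f z = 0}"
  have ball: "ball p r \<subseteq> Z" if p: "ball p r \<subseteq> U" "q \<in> Z" "q \<in> ball p r" for p q r
  proof -
    have "f x = 0" if x: "x \<in> ball p r" for x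
    proof -
      \<comment> \<open>The parameter 0 gives \<open>q\<close> and 1 gives \<open>x\<close>.
        Convexity of the ball makes \<open>D\<close> convex, hence connected.\<close>
      define D where "D = {s. q + s *s (x - q) \<in> ball p r}"
      have oD: "open D" unfolding D_def by (rule open_slice) simp
      have "(\<lambda>s. f (q + s *s (x - q))) holomorphic_on D"
        unfolding D_def by (rule holomorphic_on_slice) (use f p in \<open>auto intro: holomorphic_Cn_on_subset\<close>)
      moreover have "convex D"
      proof (rule convexI)
        fix a b :: complex and u v :: real
        assume ab: "a \<in> D" "b \<in> D" "0 \<le> u" "0 \<le> v" "u + v = 1"
        have "u *\<^sub>R (q + a *s (x - q)) + v *\<^sub>R (q + b *s (x - q)) \<in> ball p r"
          using ab by (intro convexD[OF convex_ball]) (auto simp: D_def)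
        also have "u *\<^sub>R (q + a *s (x - q)) + v *\<^sub>R (q + b *s (x - q))
            = (u + v) *\<^sub>R q + (u *\<^sub>R a + v *\<^sub>R b) *s (x - q)"
          by (simp add: vec_eq_iff algebra_simps)
        finally show "u *\<^sub>R a + v *\<^sub>R b \<in> D" using ab by (simp add: D_def)
      qed
      moreover define E where "E = D \<inter> {s. q + s *s (x - q) \<in> Z}"
      have "open E" unfolding E_def by (intro open_Int oD open_slice) (simp add: Z_def)
      moreover have "0 \<in> E" using p by (simp add: E_def D_def)
      moreover have "E \<subseteq> D" by (auto simp: E_def)
      moreover have "f (q + s *s (x - q)) = 0" if "s \<in> E" for s
        using that interior_subset[of "{z\<in>U. f z = 0}"] by (auto simp: E_def Z_def)
      moreover have "1 \<in> D" using x by (simp add: D_def)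
      ultimately have "f (q + 1 *s (x - q)) = 0"
        using analytic_continuation_open[of E D "\<lambda>s. f (q + s *s (x - q))" "\<lambda>_. 0" 1] oD convex_connected
        by fastforce
      then show ?thesis by simp
    qed
    then show ?thesis unfolding Z_def using p by (intro interior_maximal) auto
  qed
  have "openin (top_of_set U) Z"
    unfolding Z_def by (rule open_openin_trans) (use U interior_subset in auto)
  moreover have "closedin (top_of_set U) Z"
  proof -
    have "x \<in> Z" if "x \<in> U" "x \<in> closure Z" for x
    proof -
      obtain r where r: "r > 0" "ball x r \<subseteq> U" using U \<open>x \<in> U\<close> openE by blast
      then obtain q where "q \<in> Z" "dist q x < r" using \<open>x \<in> closure Z\<close> closure_approachable by blast
      then show ?thesis using ball[OF r(2), of q] r by (auto simp: dist_commute)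
    qed
    moreover have "Z \<subseteq> U" unfolding Z_def using interior_subset by fastforce
    ultimately have "Z = U \<inter> closure Z" using closure_subset by blast
    then show ?thesis by (metis closed_closure closedin_closed)
  qed
  moreover have "W \<subseteq> Z" unfolding Z_def using W by (intro interior_maximal) auto
  ultimately have "Z = U" using U(2) W(2) unfolding connected_clopen by blast
  then show ?thesis using z interior_subset[of "{z\<in>U. f z = 0}"] unfolding Z_def by auto
qed

text \<open>The integral over the ball is unchanged by the rotations
  \<open>z \<mapsto> e t *s z\<close>, so it equals its average over \<open>t\<close> in [0,1].
  After Fubini, the inner average for fixed \<open>z\<close> is a circle mean on the complex line
  through \<open>w\<close> and equals \<open>f w\<close>.\<close>

lemma ball_mean_value:
  fixes f :: "complex ^ 'n \<Rightarrow> complex"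
  assumes f: "holomorphic_Cn_on f U" and U: "open U" "cball w r \<subseteq> U"
  shows "(LINT z:cball 0 r|lborel. f (w + z)) = of_real (measure lborel (cball (0 :: complex ^ 'n) r)) * f w"
proof -
  define B where "B = cball (0 :: complex ^ 'n) r"
  define e where "e = (\<lambda>t::real. exp (2 * of_real pi * \<i> * of_real t))"
  have ne: "cmod (e t) = 1" for t
    by (simp add: e_def)
  have ce: "continuous_on S e" for S
    unfolding e_def by (intro continuous_intros)
  have [measurable]: "B \<in> sets borel" by (simp add: B_def)
  have wB: "w + z \<in> U" if "norm z \<le> r" for z
    using that U(2) by (auto simp: subset_iff dist_norm)
  define h where "h = (\<lambda>z. indicator B z *\<^sub>R f (w + z))"
  have [measurable]: "h \<in> borel_measurable borel"
    unfolding h_def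
    by (intro borel_measurable_continuous_on_indicator)
       (auto intro!: continuous_intros continuous_on_compose2[OF holomorphic_Cn_on_imp_continuous_on[OF f]] wB
             simp: B_def)
  have rot: "(LINT z|lborel. h (e t *s z)) = (LINT z|lborel. h z)" for t
  proof -
    have o: "orthogonal_transformation (\<lambda>z :: complex ^ 'n. e t *s z)"
      by (rule orthogonal_transformation_unit_scalar) (rule ne)
    have [measurable]: "(\<lambda>z :: complex ^ 'n. e t *s z) \<in> borel_measurable borel"
      by (intro borel_measurable_continuous_onI continuous_intros)
    have "(LINT z|lborel. h z) = (LINT z|distr lborel borel (\<lambda>z. e t *s z). h z)"
      by (simp only: lborel_distr_orthogonal_transformation[OF o])
    also have "\<dots> = (LINT z|lborel. h (e t *s z))"
      by (rule integral_distr) auto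
    finally show ?thesis ..
  qed
  define G where "G = (\<lambda>t z. indicator {0..1::real} t *\<^sub>R h (e t *s z))"
  \<comment> \<open>Joint integrability for Fubini: the integrand is continuous on a compact
    product, and the norm-preserving rotation lets the indicator of \<open>B\<close> be taken at
    \<open>z\<close> itself.\<close>
  have "integrable lborel (\<lambda>p. indicator ({0..1} \<times> B) p *\<^sub>R f (w + e (fst p) *s snd p))"
    by (intro borel_integrable_compact compact_Times compact_Icc)
       (auto intro!: continuous_intros continuous_on_compose2[OF ce[of UNIV]] wB
            continuous_on_compose2[OF holomorphic_Cn_on_imp_continuous_on[OF f]]
             simp: B_def norm_complex_vector_scalar_mult ne)
  also have "(\<lambda>p. indicator ({0..1} \<times> B) p *\<^sub>R f (w + e (fst p) *s snd p)) = (\<lambda>p. case p of (t, z) \<Rightarrow> G t z)"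
    by (auto simp: G_def h_def fun_eq_iff indicator_def B_def norm_complex_vector_scalar_mult ne)
  finally have int: "integrable (lborel \<Otimes>\<^sub>M lborel) (\<lambda>(t, z). G t z)"
    by (simp add: lborel_prod)
  have "(LINT z|lborel. h z) = (LINT t|lborel. indicator {0..1::real} t *\<^sub>R (LINT z|lborel. h z))"
    by simp
  also have "\<dots> = (LINT t|lborel. (LINT z|lborel. G t z))"
    by (simp add: G_def rot)
  also have "\<dots> = (LINT z|lborel. (LINT t|lborel. G t z))"
    by (rule lborel_pair.Fubini_integral[OF int, symmetric])
  also have "\<dots> = (LINT z|lborel. indicator B z *\<^sub>R f w)"
  proof (rule Bochner_Integration.integral_cong[OF refl])
    fix z :: "complex ^ 'n"
    show "(LINT t|lborel. G t z) = indicator B z *\<^sub>R f w"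
    proof (cases "z \<in> B")
      case False
      then have "G t z = 0" for t
        by (auto simp: G_def h_def indicator_def B_def norm_complex_vector_scalar_mult ne)
      then show ?thesis using False by simp
    next
      case True
      have "(LINT t:{0..1}|lborel. f (w + e t *s z)) = f (w + 0 *s z)"
        unfolding e_def
      proof (rule circle_mean_value[where f="\<lambda>s. f (w + s *s z)"])
        show "(\<lambda>s. f (w + s *s z)) holomorphic_on {s. w + s *s z \<in> U}"
          by (rule holomorphic_on_slice[OF f U(1)])
        show "open {s. w + s *s z \<in> U}" by (rule open_slice[OF U(1)])
        show "cball 0 1 \<subseteq> {s. w + s *s z \<in> U}"
        proof (clarsimp, rule wB)
          fix s :: complex assume "cmod s \<le> 1"
          then show "norm (s *s z) \<le> r"
            using True mult_left_le_one_le[of "norm z" "cmod s"]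
            by (auto simp: norm_complex_vector_scalar_mult B_def)
        qed
      qed
      moreover have "G t z = indicator {0..1} t *\<^sub>R f (w + e t *s z)" for t
        using True by (auto simp: G_def h_def indicator_def B_def norm_complex_vector_scalar_mult ne)
      ultimately show ?thesis using True by (simp add: set_lebesgue_integral_def)
    qed
  qed
  also have "\<dots> = of_real (measure lborel B) * f w"
    by (simp add: scaleR_conv_of_real B_def)
  finally show ?thesis by (simp add: B_def h_def set_lebesgue_integral_def)
qed

lemma holomorphic_Cn_on_const: "holomorphic_Cn_on (\<lambda>_. c) U"
  unfolding holomorphic_Cn_on_def by (auto intro!: exI[of _ "\<lambda>_. 0"])

lemma holomorphic_Cn_on_add:
  assumes "holomorphic_Cn_on f U" "holomorphic_Cn_on g U"
  shows "holomorphic_Cn_on (\<lambda>z. f z + g z) U"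
  unfolding holomorphic_Cn_on_def
proof
  fix z assume "z \<in> U"
  with assms obtain f' g' where
    "(f has_derivative f') (at z within U)" "\<And>c v. f' (c *s v) = c * f' v"
    "(g has_derivative g') (at z within U)" "\<And>c v. g' (c *s v) = c * g' v"
    unfolding holomorphic_Cn_on_def by metis
  then show "\<exists>f'. ((\<lambda>z. f z + g z) has_derivative f') (at z within U) \<and> (\<forall>c v. f' (c *s v) = c * f' v)"
    by (intro exI[of _ "\<lambda>v. f' v + g' v"]) (auto intro!: derivative_intros simp: algebra_simps)
qed

lemma holomorphic_Cn_on_mult:
  assumes "holomorphic_Cn_on f U" "holomorphic_Cn_on g U"
  shows "holomorphic_Cn_on (\<lambda>z. f z * g z) U"
  unfolding holomorphic_Cn_on_def
proof
  fix z assume "z \<in> U"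
  with assms obtain f' g' where
    "(f has_derivative f') (at z within U)" "\<And>c v. f' (c *s v) = c * f' v"
    "(g has_derivative g') (at z within U)" "\<And>c v. g' (c *s v) = c * g' v"
    unfolding holomorphic_Cn_on_def by metis
  then show "\<exists>f'. ((\<lambda>z. f z * g z) has_derivative f') (at z within U) \<and> (\<forall>c v. f' (c *s v) = c * f' v)"
    by (intro exI[of _ "\<lambda>v. f z * g' v + f' v * g z"]) (auto intro!: derivative_intros simp: algebra_simps)
qed

lemma holomorphic_Cn_on_measurable:
  assumes "holomorphic_Cn_on f U" "open U"
  shows "(\<lambda>z. indicator U z *\<^sub>R f z) \<in> borel_measurable borel"
  using assms by (intro borel_measurable_continuous_on_indicator holomorphic_Cn_on_imp_continuous_on) auto

section \<open>The Bergman space as a Hilbert space\<close>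

definition bergman_sqnorm :: "(complex ^ 'n) set \<Rightarrow> (complex ^ 'n \<Rightarrow> complex) \<Rightarrow> real" where
  "bergman_sqnorm U f = (LINT z:U|lebesgue. (cmod (f z))\<^sup>2)"

lemma bergman_sqnorm_nonneg: "0 \<le> bergman_sqnorm U f"
  unfolding bergman_sqnorm_def set_lebesgue_integral_def by (rule integral_nonneg_AE) auto

lemma bergman_product_integrable:
  assumes "f \<in> bergman_space U" "g \<in> bergman_space U" "open U"
  shows "set_integrable lebesgue U (\<lambda>z. f z * cnj (g z))"
  unfolding set_integrable_def
proof (rule Bochner_Integration.integrable_bound)
  show "integrable lebesgue (\<lambda>z. indicator U z *\<^sub>R (cmod (f z))\<^sup>2 + indicator U z *\<^sub>R (cmod (g z))\<^sup>2)"
    using assms by (intro Bochner_Integration.integrable_add) (auto simp: bergman_space_def set_integrable_def)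
  have [measurable]: "(\<lambda>z. indicator U z *\<^sub>R f z) \<in> borel_measurable borel"
    "(\<lambda>z. indicator U z *\<^sub>R g z) \<in> borel_measurable borel"
    using assms by (auto intro!: holomorphic_Cn_on_measurable simp: bergman_space_def)
  have cnj_meas: "cnj \<in> borel_measurable borel"
    by (intro borel_measurable_continuous_onI continuous_intros)
  have "(\<lambda>z. (indicator U z *\<^sub>R f z) * cnj (indicator U z *\<^sub>R g z)) \<in> borel_measurable borel"
    by (intro borel_measurable_times measurable_compose[OF _ cnj_meas]) fact+
  also have "(\<lambda>z. (indicator U z *\<^sub>R f z) * cnj (indicator U z *\<^sub>R g z)) = (\<lambda>z. indicator U z *\<^sub>R (f z * cnj (g z)))"
    by (auto simp: indicator_def)
  finally show "(\<lambda>z. indicator U z *\<^sub>R (f z * cnj (g z))) \<in> borel_measurable lebesgue"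
    by (simp add: measurable_completion)
  \<comment> \<open>The product is dominated pointwise by the sum of the two squared moduli.\<close>
  have "x * y \<le> x\<^sup>2 + y\<^sup>2" if "x \<ge> 0" "y \<ge> 0" for x y :: real
    using that sum_squares_bound[of x y] mult_nonneg_nonneg[OF that] by linarith
  then show "AE z in lebesgue. norm (indicator U z *\<^sub>R (f z * cnj (g z)))
      \<le> norm (indicator U z *\<^sub>R (cmod (f z))\<^sup>2 + indicator U z *\<^sub>R (cmod (g z))\<^sup>2)"
    by (auto simp: indicator_def norm_mult)
qed

lemma bergman_space_cmult:
  assumes "f \<in> bergman_space U"
  shows "(\<lambda>z. c * f z) \<in> bergman_space U"
  using assms set_integrable_mult_right[of "(cmod c)\<^sup>2" lebesgue U "\<lambda>z. (cmod (f z))\<^sup>2"]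
  by (auto simp: bergman_space_def norm_mult power_mult_distrib
      intro!: holomorphic_Cn_on_mult holomorphic_Cn_on_const)

lemma cmod_add_squared_eq: "(cmod (a + b))\<^sup>2 = (cmod a)\<^sup>2 + (cmod b)\<^sup>2 + 2 * Re (a * cnj b)"
  unfolding cmod_power2 by (simp add: power2_eq_square algebra_simps)

lemma bergman_space_add:
  assumes "f \<in> bergman_space U" "g \<in> bergman_space U" "open U"
  shows "(\<lambda>z. f z + g z) \<in> bergman_space U"
proof -
  have "set_integrable lebesgue U (\<lambda>z. Re (f z * cnj (g z)))"
    using integrable_Re[OF bergman_product_integrable[OF assms, unfolded set_integrable_def]]
    by (simp add: set_integrable_def)
  then have "set_integrable lebesgue U (\<lambda>z. (cmod (f z))\<^sup>2 + (cmod (g z))\<^sup>2 + 2 * Re (f z * cnj (g z)))"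
    using assms by (intro set_integral_add set_integrable_mult_right) (auto simp: bergman_space_def)
  then show ?thesis
    using assms unfolding cmod_add_squared_eq[symmetric]
    by (auto simp: bergman_space_def intro: holomorphic_Cn_on_add)
qed

lemma bergman_space_diff:
  assumes "f \<in> bergman_space U" "g \<in> bergman_space U" "open U"
  shows "(\<lambda>z. f z - g z) \<in> bergman_space U"
  using bergman_space_add[OF assms(1) bergman_space_cmult[OF assms(2), of "-1"] assms(3)] by simp

lemma bergman_inner_add_left:
  assumes "f \<in> bergman_space U" "g \<in> bergman_space U" "h \<in> bergman_space U" "open U"
  shows "bergman_inner U (\<lambda>z. f z + g z) h = bergman_inner U f h + bergman_inner U g h"
  unfolding bergman_inner_def distrib_right
  using assms by (intro set_integral_add bergman_product_integrable)

lemma bergman_inner_cmult_left: "bergman_inner U (\<lambda>z. c * f z) h = c * bergman_inner U f h"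
  by (simp add: bergman_inner_def mult.assoc)

lemma bergman_inner_commute: "bergman_inner U g f = cnj (bergman_inner U f g)"
proof -
  have "bergman_inner U g f = (LINT z|lebesgue. cnj (indicator U z *\<^sub>R (f z * cnj (g z))))"
    unfolding bergman_inner_def set_lebesgue_integral_def by (simp add: mult.commute)
  also have "\<dots> = cnj (bergman_inner U f g)"
    unfolding bergman_inner_def set_lebesgue_integral_def by (rule Bochner_Integration.integral_cnj)
  finally show ?thesis .
qed

lemma bergman_inner_self: "bergman_inner U f f = of_real (bergman_sqnorm U f)"
  unfolding bergman_inner_def bergman_sqnorm_def set_integral_complex_of_real[symmetric]
  by (simp only: complex_norm_square)

lemma bergman_sqnorm_add:
  assumes "f \<in> bergman_space U" "g \<in> bergman_space U" "open U"
  shows "bergman_sqnorm U (\<lambda>z. f z + g z)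
    = bergman_sqnorm U f + bergman_sqnorm U g + 2 * Re (bergman_inner U f g)"
proof -
  let ?s = "\<lambda>z. f z + g z"
  have s: "?s \<in> bergman_space U" using assms by (rule bergman_space_add)
  \<comment> \<open>Additivity in the second argument is read off from the first by Hermitian
    symmetry.\<close>
  have *: "bergman_inner U f ?s = cnj (bergman_inner U f f + bergman_inner U g f)"
    "bergman_inner U g ?s = cnj (bergman_inner U f g + bergman_inner U g g)"
    using assms by (simp_all add: bergman_inner_commute[of U _ ?s] bergman_inner_add_left)
  have "bergman_inner U ?s ?s = cnj (bergman_inner U f f + bergman_inner U g f)
      + cnj (bergman_inner U f g + bergman_inner U g g)"
    using assms s by (simp add: bergman_inner_add_left *)
  from arg_cong[OF this, of Re] show ?thesis
    by (simp add: bergman_inner_self bergman_inner_commute[of U g f])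
qed

lemma bergman_sqnorm_cmult: "bergman_sqnorm U (\<lambda>z. c * f z) = (cmod c)\<^sup>2 * bergman_sqnorm U f"
  by (simp add: bergman_sqnorm_def norm_mult power_mult_distrib)

lemma bergman_sqnorm_diff:
  assumes "f \<in> bergman_space U" "g \<in> bergman_space U" "open U"
  shows "bergman_sqnorm U (\<lambda>z. f z - g z)
    = bergman_sqnorm U f + bergman_sqnorm U g - 2 * Re (bergman_inner U f g)"
proof -
  have "bergman_inner U f (\<lambda>z. - g z) = - bergman_inner U f g"
    by (simp add: bergman_inner_def set_lebesgue_integral_def)
  moreover have "bergman_sqnorm U (\<lambda>z. - g z) = bergman_sqnorm U g"
    by (simp add: bergman_sqnorm_def)
  ultimately show ?thesis
    using bergman_sqnorm_add[OF assms(1) bergman_space_cmult[OF assms(2), of "-1"] assms(3)] by simp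
qed

text \<open>An additive form of Cauchy-Schwarz, from the nonnegativity of the squared norm of
  \<open>f - g\<close>.\<close>

lemma bergman_inner_le_sqnorm:
  assumes "f \<in> bergman_space U" "g \<in> bergman_space U" "open U"
  shows "2 * Re (bergman_inner U f g) \<le> bergman_sqnorm U f + bergman_sqnorm U g"
  using bergman_sqnorm_diff[OF assms] bergman_sqnorm_nonneg[of U "\<lambda>z. f z - g z"] by linarith

lemma bergman_space_subset:
  assumes "f \<in> bergman_space U" "V \<subseteq> U" "open V"
  shows "f \<in> bergman_space V"
  using assms set_integrable_subset[of lebesgue U _ V]
  by (auto simp: bergman_space_def intro: holomorphic_Cn_on_subset)

lemma bergman_sqnorm_mono:
  assumes "f \<in> bergman_space U" "V \<subseteq> U" "open V"
  shows "bergman_sqnorm V f \<le> bergman_sqnorm U f"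
  unfolding bergman_sqnorm_def set_lebesgue_integral_def
  using assms bergman_space_subset[OF assms]
  by (intro integral_mono) (auto simp: bergman_space_def set_integrable_def indicator_def)

section \<open>Point evaluations\<close>

text \<open>The mean value property is applied to the holomorphic function \<open>f * f\<close>,
  whose modulus is the integrand of the squared norm.\<close>

lemma bergman_point_evaluation_bound:
  fixes f :: "complex ^ 'n \<Rightarrow> complex"
  assumes f: "f \<in> bergman_space U" and U: "open U" "cball w r \<subseteq> U"
  shows "measure lborel (cball (0 :: complex ^ 'n) r) * (cmod (f w))\<^sup>2 \<le> bergman_sqnorm U f"
proof -
  let ?B = "cball (0 :: complex ^ 'n) r"
  have hol: "holomorphic_Cn_on f U" using f by (simp add: bergman_space_def)
  have [measurable]: "(\<lambda>z. indicator U z *\<^sub>R f z) \<in> borel_measurable borel"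
    using hol U by (intro holomorphic_Cn_on_measurable)
  have "(\<lambda>z. (cmod (indicator U z *\<^sub>R f z))\<^sup>2) \<in> borel_measurable lborel"
    by measurable
  also have "(\<lambda>z. (cmod (indicator U z *\<^sub>R f z))\<^sup>2) = (\<lambda>z. indicator U z *\<^sub>R (cmod (f z))\<^sup>2)"
    by (auto simp: indicator_def)
  finally have m: "(\<lambda>z. indicator U z *\<^sub>R (cmod (f z))\<^sup>2) \<in> borel_measurable lborel" .
  \<comment> \<open>The integrand is Borel measurable, so integrals over the completed measure and
    over \<open>lborel\<close> agree.\<close>
  have intU: "set_integrable lborel U (\<lambda>z. (cmod (f z))\<^sup>2)"
    using f integrable_completion[OF m] by (simp add: bergman_space_def set_integrable_def)
  have intB: "set_integrable lborel (cball w r) (\<lambda>z. (cmod (f z))\<^sup>2)"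
    by (rule set_integrable_subset[OF intU]) (use U in auto)
  have "measure lborel ?B * (cmod (f w))\<^sup>2 = cmod (of_real (measure lborel ?B) * (f w * f w))"
    by (simp add: norm_mult power2_eq_square)
  also have "\<dots> = cmod (LINT z:?B|lborel. f (w + z) * f (w + z))"
    using ball_mean_value[OF holomorphic_Cn_on_mult[OF hol hol] U] by simp
  also have "\<dots> \<le> (LINT z:?B|lborel. cmod (f (w + z) * f (w + z)))"
    unfolding set_lebesgue_integral_def by (rule order_trans[OF integral_norm_bound]) simp
  also have "\<dots> = (LINT z|lborel. indicator (cball w r) (w + z) *\<^sub>R (cmod (f (w + z)))\<^sup>2)"
    unfolding set_lebesgue_integral_def
    by (auto intro!: Bochner_Integration.integral_cong simp: norm_mult power2_eq_square indicator_def dist_norm)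
  also have "\<dots> = (LINT z|distr lborel borel ((+) w). indicator (cball w r) z *\<^sub>R (cmod (f z))\<^sup>2)"
    using borel_measurable_integrable[OF intB[unfolded set_integrable_def]]
    by (intro integral_distr[symmetric]) auto
  also have "\<dots> = (LINT z:cball w r|lborel. (cmod (f z))\<^sup>2)"
    by (simp add: lborel_distr_plus set_lebesgue_integral_def)
  also have "\<dots> \<le> (LINT z:U|lborel. (cmod (f z))\<^sup>2)"
    unfolding set_lebesgue_integral_def using intU intB U
    by (intro integral_mono) (auto simp: set_integrable_def indicator_def)
  also have "\<dots> = bergman_sqnorm U f"
    using integral_completion[OF m] by (simp add: bergman_sqnorm_def set_lebesgue_integral_def)
  finally show ?thesis .
qed

lemma bergman_sqnorm_zero_imp:
  fixes f :: "complex ^ 'n \<Rightarrow> complex"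
  assumes "f \<in> bergman_space U" "open U" "bergman_sqnorm U f = 0" "w \<in> U"
  shows "f w = 0"
proof -
  obtain r where r: "r > 0" "cball w r \<subseteq> U" using assms open_contains_cball by blast
  have "measure lborel (cball (0 :: complex ^ 'n) r) > 0" using r content_cball_pos by blast
  then have "(cmod (f w))\<^sup>2 \<le> 0"
    using bergman_point_evaluation_bound[OF assms(1,2) r(2)] assms(3)
    by (metis mult_le_cancel_left_pos mult_zero_right)
  then show ?thesis by simp
qed

section \<open>Derivative estimates and completeness\<close>

text \<open>Cauchy's inequality on the complex line through \<open>p\<close> in direction
  \<open>v\<close>. The radius \<open>R = r / norm v\<close> is the largest for which the slice disc
  stays in the ball.\<close>

lemma has_derivative_bound_of_bounded:
  fixes f :: "complex ^ 'n \<Rightarrow> complex"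
  assumes f: "holomorphic_Cn_on f U" "open U" and r: "r > 0" "cball p r \<subseteq> U"
    and M: "\<And>z. z \<in> cball p r \<Longrightarrow> cmod (f z) \<le> M"
    and d: "(f has_derivative f') (at p)" "\<And>c v. f' (c *s v) = c * f' v"
  shows "cmod (f' v) \<le> M / r * norm v"
proof (cases "v = 0")
  case True
  then show ?thesis using d(2)[of 0 0] by simp
next
  case False
  define R where "R = r / norm v"
  define D where "D = {s. p + s *s v \<in> U}"
  have R: "R > 0" using False r by (simp add: R_def)
  have inb: "p + s *s v \<in> cball p r" if "cmod s \<le> R" for s
    using that False by (simp add: R_def dist_norm norm_complex_vector_scalar_mult pos_le_divide_eq)
  then have sub: "cball 0 R \<subseteq> D" using r(2) by (auto simp: D_def)
  have hol: "(\<lambda>s. f (p + s *s v)) holomorphic_on D"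
    unfolding D_def by (rule holomorphic_on_slice[OF f])
  have "((\<lambda>s. f (p + s *s v)) has_field_derivative f' v) (at 0)"
    using d by (intro has_field_derivative_slice) auto
  then have "deriv (\<lambda>s. f (p + s *s v)) 0 = f' v"
    by (rule DERIV_imp_deriv)
  moreover have "cmod ((deriv ^^ 1) (\<lambda>s. f (p + s *s v)) 0) \<le> fact 1 * M / R ^ 1"
  proof (rule Cauchy_inequality[OF _ _ R])
    show "(\<lambda>s. f (p + s *s v)) holomorphic_on ball 0 R"
      using sub by (intro holomorphic_on_subset[OF hol]) (auto simp: subset_iff)
    show "continuous_on (cball 0 R) (\<lambda>s. f (p + s *s v))"
      using sub by (intro holomorphic_on_imp_continuous_on holomorphic_on_subset[OF hol])
    show "cmod (f (p + s *s v)) \<le> M" if "cmod (0 - s) = R" for s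
      using that by (intro M inb) simp
  qed
  ultimately show ?thesis using False by (simp add: R_def)
qed

text \<open>A chosen derivative gives a sequence of functions a sequence of derivatives, as the
  theorem on differentiating limits requires; the choice is meaningful where a complex-linear
  derivative exists.\<close>

definition complex_derivative :: "(complex ^ 'n \<Rightarrow> complex) \<Rightarrow> complex ^ 'n \<Rightarrow> complex ^ 'n \<Rightarrow> complex" where
  "complex_derivative f z = (SOME f'. (f has_derivative f') (at z) \<and> (\<forall>c v. f' (c *s v) = c * f' v))"

lemma complex_derivative:
  assumes "holomorphic_Cn_on f U" "open U" "z \<in> U"
  shows "(f has_derivative complex_derivative f z) (at z)"
    and "complex_derivative f z (c *s v) = c * complex_derivative f z v"
proof -
  have "\<exists>f'. (f has_derivative f') (at z) \<and> (\<forall>c v. f' (c *s v) = c * f' v)"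
    using assms unfolding holomorphic_Cn_on_def by (metis at_within_open)
  from someI_ex[OF this] show "(f has_derivative complex_derivative f z) (at z)"
    "complex_derivative f z (c *s v) = c * complex_derivative f z v"
    unfolding complex_derivative_def by auto
qed

text \<open>Point evaluation bounds \<open>f - g\<close> by \<open>e * r\<close> on the ball of
  radius \<open>r\<close> about \<open>x\<close>; the Cauchy estimate then divides by
  \<open>r\<close>.\<close>

lemma complex_derivative_diff_bound:
  fixes f g :: "complex ^ 'n \<Rightarrow> complex"
  assumes fg: "f \<in> bergman_space U" "g \<in> bergman_space U" "open U"
    and r: "r > 0" "cball p (3 * r) \<subseteq> U" and x: "x \<in> ball p r"
    and e: "e > 0" "bergman_sqnorm U (\<lambda>z. f z - g z) \<le> measure lborel (cball (0 :: complex ^ 'n) r) * (e * r)\<^sup>2"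
  shows "cmod (complex_derivative f x h - complex_derivative g x h) \<le> e * norm h"
proof -
  let ?d = "\<lambda>z. f z - g z"
  have hol: "holomorphic_Cn_on f U" "holomorphic_Cn_on g U"
    using fg by (auto simp: bergman_space_def)
  have d: "?d \<in> bergman_space U" using fg by (rule bergman_space_diff)
  \<comment> \<open>The radius \<open>3 * r\<close> is spent in three steps: from \<open>p\<close>
    to \<open>x\<close>, from \<open>x\<close> to \<open>z\<close>, and on the ball about
    \<open>z\<close> used for point evaluation.\<close>
  have sub: "cball x (2 * r) \<subseteq> cball p (3 * r)"
    using x by (intro subsetI) (smt (verit) dist_commute dist_triangle mem_ball mem_cball)
  have "x \<in> U" using r x by auto
  have "cmod (complex_derivative f x h - complex_derivative g x h) \<le> (e * r) / r * norm h"
  proof (rule has_derivative_bound_of_bounded[where f = ?d and U = U])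
    show "holomorphic_Cn_on ?d U" using d by (simp add: bergman_space_def)
    show "cball x r \<subseteq> U" using sub r subset_cball[of r "2 * r" x] by auto
    show "(?d has_derivative (\<lambda>h. complex_derivative f x h - complex_derivative g x h)) (at x)"
      using hol fg(3) \<open>x \<in> U\<close> by (intro has_derivative_diff complex_derivative(1))
    show "complex_derivative f x (c *s v) - complex_derivative g x (c *s v)
        = c * (complex_derivative f x v - complex_derivative g x v)" for c v
      using complex_derivative(2)[OF hol(1) fg(3) \<open>x \<in> U\<close>] complex_derivative(2)[OF hol(2) fg(3) \<open>x \<in> U\<close>]
      by (simp add: algebra_simps)
    fix z assume z: "z \<in> cball x r"
    have "cball z r \<subseteq> cball x (2 * r)"
      using z by (intro subsetI) (smt (verit) dist_commute dist_triangle mem_cball)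
    then have "measure lborel (cball (0 :: complex ^ 'n) r) * (cmod (?d z))\<^sup>2 \<le> bergman_sqnorm U ?d"
      using sub r by (intro bergman_point_evaluation_bound d fg) auto
    with e(2) have "measure lborel (cball (0 :: complex ^ 'n) r) * (cmod (?d z))\<^sup>2
        \<le> measure lborel (cball (0 :: complex ^ 'n) r) * (e * r)\<^sup>2"
      by linarith
    then have "(cmod (?d z))\<^sup>2 \<le> (e * r)\<^sup>2"
      using content_cball_pos[OF r(1), of "0 :: complex ^ 'n"] by simp
    then show "cmod (?d z) \<le> e * r"
      using e(1) r(1) by (simp add: power2_le_iff_abs_le)
  qed (use fg r in auto)
  then show ?thesis using r by simp
qed

definition bergman_Cauchy :: "(complex ^ 'n) set \<Rightarrow> (nat \<Rightarrow> complex ^ 'n \<Rightarrow> complex) \<Rightarrow> bool" where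
  "bergman_Cauchy U f \<longleftrightarrow>
     (\<forall>e>0. \<exists>N. \<forall>m\<ge>N. \<forall>n\<ge>N. bergman_sqnorm U (\<lambda>z. f m z - f n z) \<le> e)"

lemma bergman_Cauchy_pointwise:
  fixes f :: "nat \<Rightarrow> complex ^ 'n \<Rightarrow> complex"
  assumes f: "\<And>n. f n \<in> bergman_space U" "open U" "bergman_Cauchy U f" and w: "w \<in> U"
  shows "Cauchy (\<lambda>n. f n w)"
proof (rule metric_CauchyI)
  fix e :: real assume e: "e > 0"
  obtain r where r: "r > 0" "cball w r \<subseteq> U" using f(2) w open_contains_cball by blast
  define V where "V = measure lborel (cball (0 :: complex ^ 'n) r)"
  have V: "V > 0" using content_cball_pos[OF r(1), of "0 :: complex ^ 'n"] by (auto simp: V_def)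
  \<comment> \<open>With this threshold the factor \<open>V\<close> cancels from the evaluation
    bound, leaving \<open>e / 2\<close>.\<close>
  obtain N where N: "\<And>m n. m \<ge> N \<Longrightarrow> n \<ge> N \<Longrightarrow> bergman_sqnorm U (\<lambda>z. f m z - f n z) \<le> V * (e / 2)\<^sup>2"
    using f(3) V e unfolding bergman_Cauchy_def by (meson mult_pos_pos half_gt_zero zero_less_power)
  have "dist (f m w) (f n w) < e" if "m \<ge> N" "n \<ge> N" for m n
  proof -
    have "V * (cmod (f m w - f n w))\<^sup>2 \<le> V * (e / 2)\<^sup>2"
      using bergman_point_evaluation_bound[OF bergman_space_diff[OF f(1)[of m] f(1)[of n] f(2)] f(2) r(2)] N[OF that]
      unfolding V_def by linarith
    then have "cmod (f m w - f n w) \<le> e / 2"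
      using V e by (simp add: power2_le_iff_abs_le)
    then show ?thesis using e by (simp add: dist_norm)
  qed
  then show "\<exists>M. \<forall>m\<ge>M. \<forall>n\<ge>M. dist (f m w) (f n w) < e" by blast
qed

text \<open>Near each point the derivatives are Cauchy uniformly in the operator sense, so the limit
  is differentiable with the limit derivative, and complex homogeneity passes to the limit.\<close>

lemma bergman_Cauchy_limit_holomorphic:
  fixes f :: "nat \<Rightarrow> complex ^ 'n \<Rightarrow> complex"
  assumes f: "\<And>n. f n \<in> bergman_space U" "open U" "bergman_Cauchy U f"
    and g: "\<And>z. z \<in> U \<Longrightarrow> (\<lambda>n. f n z) \<longlonglongrightarrow> g z"
  shows "holomorphic_Cn_on g U"
  unfolding holomorphic_Cn_on_def
proof
  fix p assume "p \<in> U"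
  then obtain r0 where r0: "r0 > 0" "cball p r0 \<subseteq> U" using f(2) open_contains_cball by blast
  define r where "r = r0 / 3"
  have r: "r > 0" "cball p (3 * r) \<subseteq> U" using r0 by (auto simp: r_def)
  have BU: "ball p r \<subseteq> U" using r by (auto simp: subset_iff)
  have hol: "holomorphic_Cn_on (f n) U" for n using f by (simp add: bergman_space_def)
  define D where "D = (\<lambda>n. complex_derivative (f n))"
  have unif: "\<exists>N. \<forall>m\<ge>N. \<forall>n\<ge>N. \<forall>x\<in>ball p r. \<forall>h. cmod (D m x h - D n x h) \<le> e * norm h"
    if e: "e > 0" for e
  proof -
    have "measure lborel (cball (0 :: complex ^ 'n) r) * (e * r)\<^sup>2 > 0"
      using content_cball_pos[OF r(1), of "0 :: complex ^ 'n"] r e by simp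
    then obtain N where "\<forall>m\<ge>N. \<forall>n\<ge>N. bergman_sqnorm U (\<lambda>z. f m z - f n z)
        \<le> measure lborel (cball (0 :: complex ^ 'n) r) * (e * r)\<^sup>2"
      using f(3) unfolding bergman_Cauchy_def by blast
    then show ?thesis
      unfolding D_def
      by (intro exI[of _ N] allI impI ballI complex_derivative_diff_bound[OF f(1) f(1) f(2) r _ e]) auto
  qed
  have Dlim: "(\<lambda>n. D n x h) \<longlonglongrightarrow> lim (\<lambda>n. D n x h)" if x: "x \<in> ball p r" for x h
  proof -
    have "Cauchy (\<lambda>n. D n x h)"
    proof (rule metric_CauchyI)
      fix e :: real assume "e > 0"
      \<comment> \<open>Adding 1 keeps the denominator positive when \<open>h = 0\<close>.\<close>
      then have e': "e / (norm h + 1) > 0" by (simp add: add_nonneg_pos)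
      obtain N where N: "\<And>m n. m \<ge> N \<Longrightarrow> n \<ge> N \<Longrightarrow> cmod (D m x h - D n x h) \<le> e / (norm h + 1) * norm h"
        using unif[OF e'] x by meson
      have "e * norm h < e * (norm h + 1)" using \<open>e > 0\<close> by simp
      then have "e / (norm h + 1) * norm h < e"
        using norm_ge_zero[of h] by (simp only: times_divide_eq_left pos_divide_less_eq add_nonneg_pos zero_less_one)
      then show "\<exists>M. \<forall>m\<ge>M. \<forall>n\<ge>M. dist (D m x h) (D n x h) < e"
        using N unfolding dist_norm by (meson order_le_less_trans)
    qed
    then show ?thesis by (simp add: Cauchy_convergent convergent_LIMSEQ_iff[symmetric])
  qed
  define D' where "D' = (\<lambda>x h. lim (\<lambda>n. D n x h))"
  have Dconv: "\<forall>\<^sub>F n in sequentially. \<forall>x\<in>ball p r. \<forall>h. cmod (D n x h - D' x h) \<le> e * norm h"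
    if e: "e > 0" for e
  proof -
    obtain N where N: "\<And>m n x h. m \<ge> N \<Longrightarrow> n \<ge> N \<Longrightarrow> x \<in> ball p r \<Longrightarrow> cmod (D m x h - D n x h) \<le> e * norm h"
      using unif[OF e] by metis
    have "cmod (D n x h - D' x h) \<le> e * norm h" if "n \<ge> N" "x \<in> ball p r" for n x h
    proof (rule LIMSEQ_le_const2)
      show "(\<lambda>m. cmod (D n x h - D m x h)) \<longlonglongrightarrow> cmod (D n x h - D' x h)"
        unfolding D'_def by (intro tendsto_intros Dlim that)
      show "\<exists>M. \<forall>m\<ge>M. cmod (D n x h - D m x h) \<le> e * norm h"
        using N that by blast
    qed
    then show ?thesis unfolding eventually_sequentially by blast
  qed
  have "\<exists>G. \<forall>x\<in>ball p r. (\<lambda>n. f n x) \<longlonglongrightarrow> G x \<and> (G has_derivative D' x) (at x within ball p r)"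
  proof (rule has_derivative_sequence[OF convex_ball _ Dconv])
    show "(f n has_derivative D n x) (at x within ball p r)" if "x \<in> ball p r" for n x
      unfolding D_def using that BU
      by (auto intro: has_derivative_at_withinI[OF complex_derivative(1)[OF hol f(2)]])
    show "p \<in> ball p r" using r by simp
    show "(\<lambda>n. f n p) \<longlonglongrightarrow> g p" using g \<open>p \<in> U\<close> .
  qed
  then obtain G where G: "\<And>x. x \<in> ball p r \<Longrightarrow> (\<lambda>n. f n x) \<longlonglongrightarrow> G x"
    "\<And>x. x \<in> ball p r \<Longrightarrow> (G has_derivative D' x) (at x within ball p r)"
    by blast
  \<comment> \<open>The theorem on sequences yields some limit function; uniqueness of limits
    identifies it with \<open>g\<close> on the ball.\<close>
  have Gg: "G x = g x" if "x \<in> ball p r" for x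
    using G(1)[OF that] g[OF subsetD[OF BU that]] by (rule LIMSEQ_unique)
  have pb: "p \<in> ball p r" using r by simp
  have "(g has_derivative D' p) (at p within ball p r)"
    by (rule has_derivative_transform[OF pb _ G(2)[OF pb]]) (simp add: Gg)
  then have "(g has_derivative D' p) (at p within U)"
    using pb at_within_open[OF pb open_ball] by (metis has_derivative_at_withinI)
  moreover have "D' p (c *s v) = c * D' p v" for c v
  proof -
    have "D n p (c *s v) = c * D n p v" for n
      unfolding D_def using \<open>p \<in> U\<close> by (rule complex_derivative(2)[OF hol f(2)])
    then have "(\<lambda>n. c * D n p v) \<longlonglongrightarrow> D' p (c *s v)"
      using Dlim[OF pb, of "c *s v"] by (simp add: D'_def)
    moreover have "(\<lambda>n. c * D n p v) \<longlonglongrightarrow> c * D' p v"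
      unfolding D'_def by (intro tendsto_intros Dlim pb)
    ultimately show ?thesis by (rule LIMSEQ_unique)
  qed
  ultimately show "\<exists>f'. (g has_derivative f') (at p within U) \<and> (\<forall>c v. f' (c *s v) = c * f' v)"
    by blast
qed

text \<open>Fatou's lemma for the squared moduli: a norm bound that holds eventually along the
  sequence passes to a pointwise limit, which gives membership and estimate together.\<close>

lemma bergman_Fatou:
  fixes f :: "nat \<Rightarrow> complex ^ 'n \<Rightarrow> complex"
  assumes f: "\<And>n. f n \<in> bergman_space U" "open U" and g: "holomorphic_Cn_on g U"
    "\<And>z. z \<in> U \<Longrightarrow> (\<lambda>n. f n z) \<longlonglongrightarrow> g z"
    and e: "\<And>n. n \<ge> N \<Longrightarrow> bergman_sqnorm U (f n) \<le> e"
  shows "g \<in> bergman_space U" "bergman_sqnorm U g \<le> e"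
proof -
  let ?s = "\<lambda>f z. indicator U z *\<^sub>R (cmod (f z))\<^sup>2"
  have e0: "e \<ge> 0" using e[of N] bergman_sqnorm_nonneg[of U "f N"] by linarith
  have m: "?s h \<in> borel_measurable lebesgue" if "holomorphic_Cn_on h U" for h
  proof -
    have [measurable]: "(\<lambda>z. indicator U z *\<^sub>R h z) \<in> borel_measurable borel"
      using that f(2) by (rule holomorphic_Cn_on_measurable)
    have "(\<lambda>z. (cmod (indicator U z *\<^sub>R h z))\<^sup>2) \<in> borel_measurable borel" by measurable
    also have "(\<lambda>z. (cmod (indicator U z *\<^sub>R h z))\<^sup>2) = ?s h" by (auto simp: indicator_def)
    finally show ?thesis by (simp add: measurable_completion)
  qed
  have hol: "holomorphic_Cn_on (f n) U" and int: "integrable lebesgue (?s (f n))" for n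
    using f(1)[of n] by (auto simp: bergman_space_def set_integrable_def)
  have "(\<integral>\<^sup>+z. ennreal (?s g z) \<partial>lebesgue) = (\<integral>\<^sup>+z. liminf (\<lambda>n. ennreal (?s (f n) z)) \<partial>lebesgue)"
  proof (rule nn_integral_cong)
    fix z
    have "(\<lambda>n. ?s (f n) z) \<longlonglongrightarrow> ?s g z"
    proof (cases "z \<in> U")
      case True
      then show ?thesis using g(2)[OF True] by (auto intro!: tendsto_intros)
    qed simp
    then have "(\<lambda>n. ennreal (?s (f n) z)) \<longlonglongrightarrow> ennreal (?s g z)"
      by (rule tendsto_ennrealI)
    then show "ennreal (?s g z) = liminf (\<lambda>n. ennreal (?s (f n) z))"
      by (rule lim_imp_Liminf[OF sequentially_bot, symmetric])
  qed
  also have "\<dots> \<le> liminf (\<lambda>n. \<integral>\<^sup>+z. ennreal (?s (f n) z) \<partial>lebesgue)"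
    by (rule nn_integral_liminf) (use m[OF hol] in measurable)
  also have "\<dots> = liminf (\<lambda>n. ennreal (bergman_sqnorm U (f n)))"
    unfolding bergman_sqnorm_def set_lebesgue_integral_def
    using int by (subst nn_integral_eq_integral) auto
  also have "\<dots> \<le> ennreal e"
  proof (rule Liminf_le)
    show "\<forall>\<^sub>F n in sequentially. ennreal (bergman_sqnorm U (f n)) \<le> ennreal e"
      using e e0 unfolding eventually_sequentially by (auto intro!: exI[of _ N] ennreal_leI)
  qed simp
  finally have le: "(\<integral>\<^sup>+z. ennreal (?s g z) \<partial>lebesgue) \<le> ennreal e" .
  then have i: "integrable lebesgue (?s g)"
    using m[OF g(1)] by (intro integrableI_nonneg) (auto simp: le_less_trans)
  then show "g \<in> bergman_space U"
    using g(1) by (simp add: bergman_space_def set_integrable_def)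
  have "ennreal (bergman_sqnorm U g) = (\<integral>\<^sup>+z. ennreal (?s g z) \<partial>lebesgue)"
    unfolding bergman_sqnorm_def set_lebesgue_integral_def
    using i by (subst nn_integral_eq_integral) auto
  with le show "bergman_sqnorm U g \<le> e" using e0 by (metis ennreal_le_iff)
qed

text \<open>The limit is first taken pointwise. For fixed large \<open>n\<close>, Fatou along
  \<open>f n - f m\<close> in \<open>m\<close> places \<open>f n - g\<close> in the space with small
  norm, and \<open>g\<close> is the difference of \<open>f n\<close> and this function.\<close>

lemma bergman_space_complete:
  fixes f :: "nat \<Rightarrow> complex ^ 'n \<Rightarrow> complex"
  assumes f: "\<And>n. f n \<in> bergman_space U" "open U" "bergman_Cauchy U f"
  obtains g where "g \<in> bergman_space U" "(\<lambda>n. bergman_sqnorm U (\<lambda>z. f n z - g z)) \<longlonglongrightarrow> 0"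
proof -
  define g where "g = (\<lambda>z. lim (\<lambda>n. f n z))"
  have lim: "(\<lambda>n. f n z) \<longlonglongrightarrow> g z" if "z \<in> U" for z
    using bergman_Cauchy_pointwise[OF f that]
    by (simp add: g_def Cauchy_convergent convergent_LIMSEQ_iff[symmetric])
  have hol: "holomorphic_Cn_on g U"
    using f lim by (rule bergman_Cauchy_limit_holomorphic)
  have sub: "holomorphic_Cn_on (\<lambda>z. f n z - g z) U" for n
    using holomorphic_Cn_on_add[OF _ holomorphic_Cn_on_mult[OF holomorphic_Cn_on_const[of "-1"] hol], of "f n"] f(1)[of n]
    by (simp add: bergman_space_def)
  have key: "\<exists>N. \<forall>n\<ge>N. (\<lambda>z. f n z - g z) \<in> bergman_space U \<and> bergman_sqnorm U (\<lambda>z. f n z - g z) \<le> e"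
    if e: "e > 0" for e
  proof -
    obtain N where N: "\<And>m n. m \<ge> N \<Longrightarrow> n \<ge> N \<Longrightarrow> bergman_sqnorm U (\<lambda>z. f m z - f n z) \<le> e"
      using f(3) e unfolding bergman_Cauchy_def by blast
    have "(\<lambda>z. f n z - g z) \<in> bergman_space U" "bergman_sqnorm U (\<lambda>z. f n z - g z) \<le> e" if "n \<ge> N" for n
      by (rule bergman_Fatou[where f="\<lambda>m z. f n z - f m z" and N=N];
          use f N that sub lim in \<open>auto intro!: bergman_space_diff tendsto_intros\<close>)+
    then show ?thesis by blast
  qed
  obtain n where "(\<lambda>z. f n z - g z) \<in> bergman_space U" using key[of 1] by auto
  from bergman_space_diff[OF f(1)[of n] this f(2)] have "g \<in> bergman_space U" by simp
  moreover have "(\<lambda>n. bergman_sqnorm U (\<lambda>z. f n z - g z)) \<longlonglongrightarrow> 0"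
  proof (rule LIMSEQ_I)
    fix e :: real assume "e > 0"
    with key[of "e / 2"] obtain N where "\<And>n. n \<ge> N \<Longrightarrow> bergman_sqnorm U (\<lambda>z. f n z - g z) \<le> e / 2" by auto
    moreover have "norm (a - 0) < e" if "0 \<le> a" "a \<le> e / 2" for a :: real
      using that \<open>e > 0\<close> by simp
    ultimately have "norm (bergman_sqnorm U (\<lambda>z. f n z - g z) - 0) < e" if "n \<ge> N" for n
      using that bergman_sqnorm_nonneg by blast
    then show "\<exists>N. \<forall>n\<ge>N. norm (bergman_sqnorm U (\<lambda>z. f n z - g z) - 0) < e"
      by blast
  qed
  ultimately show ?thesis by (rule that)
qed

section \<open>Riesz representation\<close>

lemma linear_coeff_zero_of_quadratic_nonneg:
  fixes a S :: real
  assumes "\<And>t. 0 \<le> t\<^sup>2 * S + t * a" and S: "S \<ge> 0"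
  shows "a = 0"
proof (rule ccontr)
  assume "a \<noteq> 0"
  \<comment> \<open>This \<open>t\<close> makes the quadratic equal to the negative of the square of
    \<open>t\<close>; the 1 covers the case \<open>S = 0\<close>.\<close>
  define t where "t = - a / (S + 1)"
  have "t * (S + 1) = - a" using S by (simp add: t_def)
  then have "t\<^sup>2 * S + t * a = - t\<^sup>2"
    by (simp add: power2_eq_square algebra_simps) algebra
  moreover have "t \<noteq> 0" using \<open>a \<noteq> 0\<close> S by (simp add: t_def)
  ultimately show False using assms(1)[of t] by (simp add: not_le[symmetric] del: not_le)
qed

lemma bergman_parallelogram:
  assumes "f \<in> bergman_space U" "g \<in> bergman_space U" "open U"
  shows "bergman_sqnorm U (\<lambda>z. f z - g z)
    = 2 * bergman_sqnorm U f + 2 * bergman_sqnorm U g - 4 * bergman_sqnorm U (\<lambda>z. 1 / 2 * (f z + g z))"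
  unfolding bergman_sqnorm_cmult[of U "1 / 2"] bergman_sqnorm_add[OF assms] bergman_sqnorm_diff[OF assms]
  by (simp add: norm_divide power2_eq_square add_divide_distrib)

text \<open>
  The representing function minimises \<open>\<parallel>f\<parallel>\<^sup>2 - 2 Re (L f)\<close>; the hypothesis on \<open>L\<close> is what makes
  this functional bounded below, and it spares us the Cauchy-Schwarz inequality.
\<close>

lemma bergman_Riesz:
  fixes L :: "(complex ^ 'n \<Rightarrow> complex) \<Rightarrow> complex"
  assumes U: "open U"
    and add: "\<And>f g. f \<in> bergman_space U \<Longrightarrow> g \<in> bergman_space U \<Longrightarrow> L (\<lambda>z. f z + g z) = L f + L g"
    and cmult: "\<And>c f. f \<in> bergman_space U \<Longrightarrow> L (\<lambda>z. c * f z) = c * L f"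
    and bound: "\<And>f. f \<in> bergman_space U \<Longrightarrow> 2 * Re (L f) \<le> bergman_sqnorm U f + C"
  obtains g where "g \<in> bergman_space U" "\<And>f. f \<in> bergman_space U \<Longrightarrow> L f = bergman_inner U f g"
proof -
  define J where "J = (\<lambda>f. bergman_sqnorm U f - 2 * Re (L f))"
  define m where "m = Inf (J ` bergman_space U)"
  have zero: "(\<lambda>_. 0) \<in> bergman_space U"
    by (simp add: bergman_space_def holomorphic_Cn_on_const set_integrable_def)
  have bdd: "bdd_below (J ` bergman_space U)"
    using bound by (intro bdd_belowI[of _ "- C"]) (fastforce simp: J_def)
  have m: "m \<le> J f" if "f \<in> bergman_space U" for f
    unfolding m_def using bdd that by (intro cInf_lower) auto
  have "\<exists>f\<in>bergman_space U. J f < m + 1 / Suc n" for n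
    using cInf_lessD[of "J ` bergman_space U" "m + 1 / Suc n"] zero by (auto simp: m_def)
  then obtain f where f: "\<And>n. f n \<in> bergman_space U" and Jf: "\<And>n. J (f n) < m + 1 / Suc n"
    by metis
  have dist: "bergman_sqnorm U (\<lambda>z. f i z - f j z) \<le> 2 / Suc i + 2 / Suc j" for i j
  proof -
    \<comment> \<open>The midpoint competes in the minimisation. In the parallelogram identity the
      linear terms cancel, so squared norms may be replaced by \<open>J\<close>, and
      \<open>m \<le> J h\<close> makes a minimising sequence Cauchy.\<close>
    define h where "h = (\<lambda>z. 1 / 2 * (f i z + f j z))"
    have s: "(\<lambda>z. f i z + f j z) \<in> bergman_space U" using f U by (intro bergman_space_add)
    have "L h = 1 / 2 * (L (f i) + L (f j))"
      unfolding h_def cmult[OF s] add[OF f f] ..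
    from arg_cong[OF this, of Re] have "Re (L h) = 1 / 2 * (Re (L (f i)) + Re (L (f j)))"
      by simp
    moreover have "bergman_sqnorm U (\<lambda>z. f i z - f j z)
        = 2 * bergman_sqnorm U (f i) + 2 * bergman_sqnorm U (f j) - 4 * bergman_sqnorm U h"
      unfolding h_def by (rule bergman_parallelogram[OF f f U])
    ultimately have "bergman_sqnorm U (\<lambda>z. f i z - f j z) = 2 * J (f i) + 2 * J (f j) - 4 * J h"
      by (simp add: J_def)
    moreover have "m \<le> J h"
      unfolding h_def using s by (intro m bergman_space_cmult)
    ultimately show ?thesis using Jf[of i] Jf[of j] by simp
  qed
  have "bergman_Cauchy U f"
    unfolding bergman_Cauchy_def
  proof (intro allI impI)
    fix e :: real assume e: "e > 0"
    obtain N where N: "1 / Suc N < e / 4" using e nat_approx_posE[of "e / 4"] by auto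
    have small: "2 / Suc n \<le> e / 2" if "n \<ge> N" for n
    proof -
      have "1 / Suc n \<le> 1 / Suc N" using that by (simp add: frac_le)
      with N show ?thesis by simp
    qed
    have "bergman_sqnorm U (\<lambda>z. f i z - f j z) \<le> e" if "i \<ge> N" "j \<ge> N" for i j
      using dist[of i j] small[OF that(1)] small[OF that(2)] by linarith
    then show "\<exists>N. \<forall>i\<ge>N. \<forall>j\<ge>N. bergman_sqnorm U (\<lambda>z. f i z - f j z) \<le> e" by blast
  qed
  from bergman_space_complete[OF f U this] obtain g
    where g: "g \<in> bergman_space U" and lim: "(\<lambda>n. bergman_sqnorm U (\<lambda>z. f n z - g z)) \<longlonglongrightarrow> 0"
    by blast
  have var: "0 \<le> bergman_sqnorm U k + (Re (bergman_inner U k g) - Re (L k))" if k: "k \<in> bergman_space U" for k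
  proof -
    let ?u = "\<lambda>n z. f n z - g z"
    \<comment> \<open>Near-minimality of \<open>f n\<close> is tested against
      \<open>f n + k\<close>. The cross term of \<open>?u n\<close> with \<open>k\<close> is
      absorbed by the additive Cauchy-Schwarz bound, at the cost of doubling the quadratic term in
      \<open>k\<close>.\<close>
    have "- (1 / Suc n) - bergman_sqnorm U (?u n)
        \<le> 2 * (bergman_sqnorm U k + (Re (bergman_inner U k g) - Re (L k)))" for n
    proof -
      have u: "?u n \<in> bergman_space U" using f g U by (intro bergman_space_diff)
      have "m \<le> J (\<lambda>z. f n z + k z)" using f k U by (intro m bergman_space_add)
      also have "\<dots> = J (f n) + bergman_sqnorm U k + 2 * Re (bergman_inner U (f n) k) - 2 * Re (L k)"
        unfolding J_def bergman_sqnorm_add[OF f k U] add[OF f k] by simp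
      finally have 1: "- (1 / Suc n) \<le> bergman_sqnorm U k + 2 * Re (bergman_inner U (f n) k) - 2 * Re (L k)"
        using Jf[of n] by linarith
      have "bergman_inner U (f n) k = bergman_inner U (?u n) k + bergman_inner U g k"
        using bergman_inner_add_left[OF u g k U] by simp
      then have 2: "Re (bergman_inner U (f n) k) = Re (bergman_inner U (?u n) k) + Re (bergman_inner U k g)"
        by (simp add: bergman_inner_commute[of U g k])
      show ?thesis
        using 1 2 bergman_inner_le_sqnorm[OF u k U] by argo
    qed
    moreover have "(\<lambda>n. - (1 / Suc n) - bergman_sqnorm U (?u n)) \<longlonglongrightarrow> - 0 - 0"
      using LIMSEQ_inverse_real_of_nat by (intro tendsto_intros lim) (simp add: inverse_eq_divide)
    ultimately show ?thesis using LIMSEQ_le_const2 by fastforce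
  qed
  have Re_eq: "Re (L h) = Re (bergman_inner U h g)" if h: "h \<in> bergman_space U" for h
  proof -
    \<comment> \<open>Taking \<open>k\<close> to be a real multiple \<open>t\<close> of
      \<open>h\<close> in \<open>var\<close> leaves a nonnegative quadratic in \<open>t\<close>
      without constant term, so its linear coefficient vanishes.\<close>
    have "Re (bergman_inner U h g) - Re (L h) = 0"
    proof (rule linear_coeff_zero_of_quadratic_nonneg)
      fix t :: real
      show "0 \<le> t\<^sup>2 * bergman_sqnorm U h + t * (Re (bergman_inner U h g) - Re (L h))"
        using var[OF bergman_space_cmult[OF h, of "of_real t"]]
        by (simp add: bergman_sqnorm_cmult bergman_inner_cmult_left cmult[OF h] algebra_simps)
    qed (rule bergman_sqnorm_nonneg)
    then show ?thesis by simp
  qed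
  \<comment> \<open>The real-part identity for \<open>\<i> * h\<close> supplies the imaginary
    parts.\<close>
  have "L h = bergman_inner U h g" if h: "h \<in> bergman_space U" for h
    using Re_eq[OF h] Re_eq[OF bergman_space_cmult[OF h, of \<i>]]
    by (simp add: complex_eq_iff cmult[OF h] bergman_inner_cmult_left)
  with g show ?thesis by (rule that)
qed

section \<open>Bergman kernels\<close>

lemma bergman_evaluation_representable:
  fixes U :: "(complex ^ 'n) set"
  assumes U: "open U" "w \<in> U"
  shows "\<exists>k\<in>bergman_space U. \<forall>f\<in>bergman_space U. f w = bergman_inner U f k"
proof -
  obtain r where r: "r > 0" "cball w r \<subseteq> U" using U open_contains_cball by blast
  define V where "V = measure lborel (cball (0 :: complex ^ 'n) r)"
  have V: "V > 0" using content_cball_pos[OF r(1), of "0 :: complex ^ 'n"] by (auto simp: V_def)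
  have bound: "2 * Re (f w) \<le> bergman_sqnorm U f + 1 / V" if "f \<in> bergman_space U" for f
  proof -
    \<comment> \<open>Completing the square turns the quadratic evaluation bound into the linear one
      that \<open>bergman_Riesz\<close> asks for, with constant \<open>1 / V\<close>.\<close>
    have "0 \<le> (V * cmod (f w) - 1)\<^sup>2 / V" using V by simp
    also have "\<dots> = V * (cmod (f w))\<^sup>2 - 2 * cmod (f w) + 1 / V"
      using V by (simp add: power2_diff power_mult_distrib power2_eq_square field_simps)
    finally show ?thesis
      using bergman_point_evaluation_bound[OF that U(1) r(2)] complex_Re_le_cmod[of "f w"]
      unfolding V_def by linarith
  qed
  obtain k where "k \<in> bergman_space U" "\<And>f. f \<in> bergman_space U \<Longrightarrow> f w = bergman_inner U f k"
    by (rule bergman_Riesz[OF U(1), of "\<lambda>f. f w" "1 / V"]) (use bound in auto)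
  then show ?thesis by blast
qed

lemma is_bergman_kernel_bergman_kernel:
  assumes "open U"
  shows "is_bergman_kernel U (bergman_kernel U)"
proof -
  obtain k where "\<And>w. w \<in> U \<Longrightarrow> k w \<in> bergman_space U \<and> (\<forall>f\<in>bergman_space U. f w = bergman_inner U f (k w))"
    using bergman_evaluation_representable[OF assms] by metis
  \<comment> \<open>The arguments are swapped: \<open>k w\<close> is the representing function of
    evaluation at \<open>w\<close>, while a kernel takes its holomorphic variable first.\<close>
  then have "is_bergman_kernel U (\<lambda>z w. k w z)"
    by (simp add: is_bergman_kernel_def)
  then show ?thesis unfolding bergman_kernel_def by (rule someI[of "is_bergman_kernel U"])
qed

lemma bergman_kernel_space:
  "open U \<Longrightarrow> w \<in> U \<Longrightarrow> (\<lambda>z. bergman_kernel U z w) \<in> bergman_space U"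
  using is_bergman_kernel_bergman_kernel unfolding is_bergman_kernel_def by blast

lemma bergman_kernel_reproducing:
  "open U \<Longrightarrow> w \<in> U \<Longrightarrow> f \<in> bergman_space U \<Longrightarrow>
    bergman_inner U f (\<lambda>z. bergman_kernel U z w) = f w"
  using is_bergman_kernel_bergman_kernel unfolding is_bergman_kernel_def by metis

text \<open>The kernel function reproduces itself. Equality on the diagonal thus becomes equality of
  squared norms.\<close>

lemma bergman_kernel_sqnorm:
  assumes "open U" "w \<in> U"
  shows "bergman_kernel U w w = of_real (bergman_sqnorm U (\<lambda>z. bergman_kernel U z w))"
  using bergman_kernel_reproducing[OF assms bergman_kernel_space[OF assms]] by (simp add: bergman_inner_self)

lemma bergman_kernel_hermitian:
  assumes "open U" "z \<in> U" "w \<in> U"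
  shows "bergman_kernel U w z = cnj (bergman_kernel U z w)"
  using assms bergman_inner_commute[of U "\<lambda>x. bergman_kernel U x z" "\<lambda>x. bergman_kernel U x w"]
  by (simp add: bergman_kernel_reproducing bergman_kernel_space)

text \<open>Each of the two functions reproduces the other at \<open>w\<close>, so both squared
  norms and both mixed inner products coincide, and the difference has norm zero.\<close>

lemma bergman_kernel_unique:
  assumes "open U" "w \<in> U" and k: "k \<in> bergman_space U"
    "\<And>f. f \<in> bergman_space U \<Longrightarrow> f w = bergman_inner U f k" and z: "z \<in> U"
  shows "bergman_kernel U z w = k z"
proof -
  let ?K = "\<lambda>z. bergman_kernel U z w"
  have K: "?K \<in> bergman_space U" using assms by (intro bergman_kernel_space)
  have "k w = of_real (bergman_sqnorm U k)"
    using k(2)[OF k(1)] by (simp add: bergman_inner_self)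
  moreover have "k w = bergman_inner U k ?K"
    using assms by (simp add: bergman_kernel_reproducing)
  moreover have "?K w = bergman_inner U ?K k"
    using k(2)[OF K] .
  moreover have "bergman_inner U ?K k = cnj (bergman_inner U k ?K)"
    by (rule bergman_inner_commute)
  moreover have "?K w = of_real (bergman_sqnorm U ?K)"
    using assms by (intro bergman_kernel_sqnorm)
  ultimately have "bergman_sqnorm U (\<lambda>z. ?K z - k z) = 0"
    unfolding bergman_sqnorm_diff[OF K k(1) assms(1)]
    by (metis Re_complex_of_real complex_cnj_complex_of_real diff_self mult_2 mult.commute)
  from bergman_sqnorm_zero_imp[OF bergman_space_diff[OF K k(1) assms(1)] assms(1) this z]
  show ?thesis by simp
qed

section \<open>The two directions of the equivalence\<close>

text \<open>\<open>bergman_kernel U\<close> at \<open>w\<close> also reproduces on \<open>V\<close>: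
  extend \<open>f\<close> to \<open>g\<close> on \<open>U\<close>, reproduce there, and discard the
  null set \<open>U - V\<close> from the inner product. Uniqueness finishes.\<close>

lemma bergman_kernel_eq_of_negligible:
  fixes U V :: "(complex ^ 'n) set"
  assumes U: "open U" and V: "open V" "V \<subseteq> U"
    and neg: "bergman_negligible U (U - V)" and w: "w \<in> V"
  shows "bergman_kernel V w w = bergman_kernel U w w"
proof (rule bergman_kernel_unique[OF V(1) w _ _ w, where k="\<lambda>z. bergman_kernel U z w"])
  let ?k = "\<lambda>z. bergman_kernel U z w"
  have wU: "w \<in> U" using w V by auto
  have k: "?k \<in> bergman_space U" using U wU by (rule bergman_kernel_space)
  then show kV: "?k \<in> bergman_space V" using V(2,1) by (rule bergman_space_subset)
  fix f assume f: "f \<in> bergman_space V"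
  have "U - (U - V) = V" using V by auto
  then obtain g where g: "g \<in> bergman_space U" "\<And>z. z \<in> V \<Longrightarrow> g z = f z"
    using neg f unfolding bergman_negligible_def by metis
  have "AE z in lebesgue. z \<notin> U - V"
    using neg by (intro AE_not_in) (simp add: bergman_negligible_def)
  then have "AE z in lebesgue. indicator U z *\<^sub>R (g z * cnj (?k z)) = indicator V z *\<^sub>R (f z * cnj (?k z))"
    by eventually_elim (use g(2) V in \<open>auto simp: indicator_def\<close>)
  then have "bergman_inner U g ?k = bergman_inner V f ?k"
    unfolding bergman_inner_def set_lebesgue_integral_def
    using bergman_product_integrable[OF g(1) k U] bergman_product_integrable[OF f kV V(1)]
    by (intro integral_cong_AE) (auto simp: set_integrable_def)
  then show "f w = bergman_inner V f ?k"
    using bergman_kernel_reproducing[OF U wU g(1)] g(2)[OF w] by simp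
qed

lemma bergman_space_const:
  assumes "open U" "bounded U"
  shows "(\<lambda>_. c) \<in> bergman_space U"
proof -
  have "U \<in> lmeasurable" using assms by (intro bounded_set_imp_lmeasurable) auto
  then have "set_integrable lebesgue U (\<lambda>_. (cmod c)\<^sup>2)"
    by (simp add: set_integrable_def lmeasurable_iff_integrable)
  then show ?thesis by (simp add: bergman_space_def holomorphic_Cn_on_const)
qed

lemma bergman_kernel_eq_of_diagonal_eq:
  fixes U V :: "(complex ^ 'n) set"
  assumes U: "open U" and V: "open V" "V \<subseteq> U" and w: "w \<in> V"
    and eq: "bergman_kernel V w w = bergman_kernel U w w"
  shows "z \<in> V \<Longrightarrow> bergman_kernel U z w = bergman_kernel V z w"
    and "AE z in lebesgue. z \<in> U - V \<longrightarrow> bergman_kernel U z w = 0"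
proof -
  let ?k = "\<lambda>z. bergman_kernel U z w" and ?p = "\<lambda>z. bergman_kernel V z w"
  have wU: "w \<in> U" using w V by auto
  have k: "?k \<in> bergman_space U" using U wU by (rule bergman_kernel_space)
  then have kV: "?k \<in> bergman_space V" using V(2,1) by (rule bergman_space_subset)
  have p: "?p \<in> bergman_space V" using V(1) w by (rule bergman_kernel_space)
  have sp: "bergman_sqnorm V ?p = bergman_sqnorm U ?k"
    using eq bergman_kernel_sqnorm[OF U wU] bergman_kernel_sqnorm[OF V(1) w] by simp
  \<comment> \<open>The kernel of \<open>V\<close> reproduces the restriction of \<open>?k\<close>,
    giving its value at \<open>w\<close>, which is the squared norm over the larger set
    \<open>U\<close>.\<close>
  have kp: "Re (bergman_inner V ?k ?p) = bergman_sqnorm U ?k"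
    using bergman_kernel_reproducing[OF V(1) w kV] bergman_kernel_sqnorm[OF U wU] by simp
  have d: "bergman_sqnorm V (\<lambda>z. ?k z - ?p z) = bergman_sqnorm V ?k - bergman_sqnorm U ?k"
    unfolding bergman_sqnorm_diff[OF kV p V(1)] sp kp by simp
  with bergman_sqnorm_mono[OF k V(2,1)] bergman_sqnorm_nonneg[of V "\<lambda>z. ?k z - ?p z"]
  have d0: "bergman_sqnorm V (\<lambda>z. ?k z - ?p z) = 0" and s: "bergman_sqnorm V ?k = bergman_sqnorm U ?k"
    by linarith+
  show "?k z = ?p z" if "z \<in> V"
    using bergman_sqnorm_zero_imp[OF bergman_space_diff[OF kV p V(1)] V(1) d0 that] by simp
  \<comment> \<open>A nonnegative function concentrated on \<open>U - V\<close>; equality of the two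
    norms of \<open>?k\<close> makes its integral zero.\<close>
  let ?h = "\<lambda>z. indicator U z *\<^sub>R (cmod (?k z))\<^sup>2 - indicator V z *\<^sub>R (cmod (?k z))\<^sup>2"
  have i: "integrable lebesgue (\<lambda>z. indicator U z *\<^sub>R (cmod (?k z))\<^sup>2)"
    "integrable lebesgue (\<lambda>z. indicator V z *\<^sub>R (cmod (?k z))\<^sup>2)"
    using k kV by (auto simp: bergman_space_def set_integrable_def)
  have "integral\<^sup>L lebesgue ?h = 0"
    using s unfolding Bochner_Integration.integral_diff[OF i] bergman_sqnorm_def set_lebesgue_integral_def by simp
  moreover have "AE z in lebesgue. 0 \<le> ?h z"
    using V by (auto simp: indicator_def)
  ultimately have "AE z in lebesgue. ?h z = 0"
    using integral_nonneg_eq_0_iff_AE[OF Bochner_Integration.integrable_diff[OF i]] by blast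
  then show "AE z in lebesgue. z \<in> U - V \<longrightarrow> ?k z = 0"
    by eventually_elim auto
qed

lemma null_set_diff_of_kernel_vanishing:
  fixes U V :: "(complex ^ 'n) set"
  assumes U: "open U" "connected U" "bounded U" and V: "open V" "V \<subseteq> U" "V \<noteq> {}"
    and ae: "\<And>w. w \<in> V \<Longrightarrow> AE z in lebesgue. z \<in> U - V \<longrightarrow> bergman_kernel U z w = 0"
  shows "U - V \<in> null_sets lebesgue"
proof -
  obtain D :: "(complex ^ 'n) set" where D: "countable D" "\<And>X. open X \<Longrightarrow> X \<noteq> {} \<Longrightarrow> \<exists>d\<in>D. d \<in> X"
    by (rule countable_dense_setE) blast
  \<comment> \<open>The exceptional null set depends on \<open>w\<close>; countability of
    \<open>D\<close> provides a common one.\<close>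
  have "AE z in lebesgue. \<forall>w\<in>D \<inter> V. z \<in> U - V \<longrightarrow> bergman_kernel U z w = 0"
    using D(1) ae by (subst AE_ball_countable) (auto intro: countable_subset)
  moreover have False if z: "z \<in> U" and 0: "\<And>w. w \<in> D \<inter> V \<Longrightarrow> bergman_kernel U z w = 0" for z
  proof -
    let ?k = "\<lambda>w. bergman_kernel U w z"
    have hol: "holomorphic_Cn_on ?k U"
      using bergman_kernel_space[OF U(1) z] by (simp add: bergman_space_def)
    \<comment> \<open>Hermitian symmetry exchanges the variables, so that the vanishing concerns a
      function holomorphic in \<open>w\<close>.\<close>
    have kD: "?k w = 0" if "w \<in> D \<inter> V" for w
      using bergman_kernel_hermitian[OF U(1) z, of w] 0[OF that] that V by auto
    have kV: "?k w = 0" if "w \<in> V" for w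
    proof (rule ccontr)
      assume "?k w \<noteq> 0"
      define X where "X = V \<inter> ?k -` (- {0})"
      have "open X" unfolding X_def
        using V holomorphic_Cn_on_imp_continuous_on[OF holomorphic_Cn_on_subset[OF hol V(2)]]
        by (intro continuous_open_preimage) auto
      moreover have "X \<noteq> {}" using that \<open>?k w \<noteq> 0\<close> by (auto simp: X_def)
      ultimately obtain d where "d \<in> D" "d \<in> X" using D(2) by blast
      then show False using kD[of d] by (auto simp: X_def)
    qed
    have "?k w = 0" if "w \<in> U" for w
      by (rule holomorphic_Cn_on_identity[OF hol U(1,2) V(1,3,2) kV that])
    then have "bergman_inner U (\<lambda>_. 1) ?k = 0"
      by (simp add: bergman_inner_def cong: set_lebesgue_integral_cong) (auto simp: set_lebesgue_integral_def indicator_def intro!: integral_eq_zero_AE)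
    moreover have "bergman_inner U (\<lambda>_. 1) ?k = 1"
      using U z by (simp add: bergman_kernel_reproducing bergman_space_const)
    ultimately show False by simp
  qed
  ultimately have "AE z in lebesgue. z \<notin> U - V"
    by (auto elim!: eventually_mono)
  then show ?thesis
    using U V by (subst AE_iff_null_sets) auto
qed

lemma bergman_extension_of_kernel_eq:
  fixes U V :: "(complex ^ 'n) set"
  assumes U: "open U" and V: "open V" "V \<subseteq> U"
    and eq: "\<And>z w. z \<in> V \<Longrightarrow> w \<in> V \<Longrightarrow> bergman_kernel U z w = bergman_kernel V z w"
    and f: "f \<in> bergman_space V"
  shows "\<exists>g\<in>bergman_space U. \<forall>z\<in>V. g z = f z"
proof -
  obtain g where g: "g \<in> bergman_space U"
    and rep: "\<And>h. h \<in> bergman_space U \<Longrightarrow> bergman_inner V h f = bergman_inner U h g"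
  \<comment> \<open>The functional is bounded with constant \<open>bergman_sqnorm V f\<close>, since
    restriction to \<open>V\<close> does not increase the norm of \<open>h\<close>.\<close>
  proof (rule bergman_Riesz[OF U, of "\<lambda>h. bergman_inner V h f" "bergman_sqnorm V f"])
    note sub = bergman_space_subset[OF _ V(2,1)]
    show "bergman_inner V (\<lambda>z. h z + k z) f = bergman_inner V h f + bergman_inner V k f"
      if "h \<in> bergman_space U" "k \<in> bergman_space U" for h k
      using sub[OF that(1)] sub[OF that(2)] f V(1) by (rule bergman_inner_add_left)
    fix h assume h: "h \<in> bergman_space U"
    show "2 * Re (bergman_inner V h f) \<le> bergman_sqnorm U h + bergman_sqnorm V f"
      using bergman_inner_le_sqnorm[OF sub[OF h] f V(1)] bergman_sqnorm_mono[OF h V(2,1)]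
      by linarith
  qed (auto simp: bergman_inner_cmult_left)
  have "g w = f w" if w: "w \<in> V" for w
  proof -
    let ?k = "\<lambda>z. bergman_kernel U z w" and ?p = "\<lambda>z. bergman_kernel V z w"
    have wU: "w \<in> U" using w V by auto
    have "g w = cnj (bergman_inner U ?k g)"
      using bergman_kernel_reproducing[OF U wU g] bergman_inner_commute[of U g ?k] by simp
    also have "\<dots> = cnj (bergman_inner V ?k f)"
      using rep[OF bergman_kernel_space[OF U wU]] by simp
    also have "\<dots> = bergman_inner V f ?k"
      by (rule bergman_inner_commute[symmetric])
    \<comment> \<open>Equality of the kernels on \<open>V\<close> enters here and makes reproduction
      on \<open>V\<close> available.\<close>
    also have "\<dots> = bergman_inner V f ?p"
      unfolding bergman_inner_def using V w eq by (intro set_lebesgue_integral_cong) auto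
    also have "\<dots> = f w" using V(1) w f by (rule bergman_kernel_reproducing)
    finally show ?thesis .
  qed
  with g show ?thesis by blast
qed

theorem proposition1p4:
  fixes U V :: "(complex ^ 'n) set"
  assumes "domain_Cn V" and "bounded V"
    and "domain_Cn U" and "bounded U"
    and "V \<subseteq> U"
  shows "(\<forall>z\<in>V. bergman_kernel V z z = bergman_kernel U z z) \<longleftrightarrow> bergman_negligible U (U - V)"
proof
  have U: "open U" "connected U" and V: "open V" "V \<noteq> {}"
    using assms by (auto simp: domain_Cn_def)
  show "\<forall>z\<in>V. bergman_kernel V z z = bergman_kernel U z z" if "bergman_negligible U (U - V)"
    using bergman_kernel_eq_of_negligible[OF U(1) V(1) assms(5) that] by blast
  assume eq: "\<forall>z\<in>V. bergman_kernel V z z = bergman_kernel U z z"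
  note * = bergman_kernel_eq_of_diagonal_eq[OF U(1) V(1) assms(5) _ eq[rule_format]]
  have "closedin (top_of_set U) (U - V)"
    using V(1) U(1) assms(5) by (intro closedin_diff closedin_self) (auto intro: open_openin_trans)
  moreover have "U - V \<in> null_sets lebesgue"
    using U V assms *(2) by (intro null_set_diff_of_kernel_vanishing) auto
  moreover have "U - (U - V) = V" using assms(5) by auto
  ultimately show "bergman_negligible U (U - V)"
    unfolding bergman_negligible_def
    using bergman_extension_of_kernel_eq[OF U(1) V(1) assms(5) *(1)] by auto
qed

end
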